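(* Let $\mathcal{D}\ge 1$ be the space dimension, and consider on the infinite grid (Cauchy problem) the second-order accurate recursive convolution scheme $$\mathbf{E}_{\mathbf j}^{n+1}=2\mathbf{E}_{\mathbf j}^{n}-\mathbf{E}_{\mathbf j}^{n-1}+\Delta t^2\Big(c^2\Delta_{2h}\mathbf{E}_{\mathbf j}^{n}-\frac{\omega_p^2}{\epsilon_r}\mathbf{E}_{\mathbf j}^{n}+\frac{\omega_p^2\gamma}{\epsilon_r}\boldsymbol{\psi}_{\mathbf j}^{n}\Big),$$ $$\boldsymbol{\psi}_{\mathbf j}^{n+1}=\frac{\Delta t}{2}\mathbf{E}_{\mathbf j}^{n+1}+\frac{\Delta t}{2}e^{-\gamma\Delta t}\mathbf{E}_{\mathbf j}^{n}+e^{-\gamma\Delta t}\boldsymbol{\psi}_{\mathbf j}^{n}.$$ If $\gamma\neq 0$ and $\omega_p\neq 0$, then the scheme admits exponential growth, i.e. there exists a nontrivial solution of the form $\mathbf{E}_{\mathbf j}^n=\mathbf{C}_E A^n e^{i\mathbf{k}\cdot\mathbf{x}_{\mathbf j}}$, $\boldsymbol{\psi}_{\mathbf j}^n=\mathbf{C}_\psi A^n e^{i\mathbf{k}\cdot\mathbf{x}_{\mathbf j}}$ with $\mathbf{k}\in\mathbb{R}^{\mathcal D}$, $A\in\mathbb{C}$ and $|A|>1$.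
   Context: The grid points are $\mathbf{x}_{\mathbf j}=(j_1h_1,\dots,j_{\mathcal D}h_{\mathcal D})$, $\mathbf{j}\in\mathbb{Z}^{\mathcal D}$, with grid spacings $h_d>0$; $\Delta t>0$ is the time step. The unknowns $\mathbf{E}_{\mathbf j}^n,\boldsymbol{\psi}_{\mathbf j}^n$ take values in $\mathbb{C}^3$. They approximate, at $(\mathbf{x}_{\mathbf j},n\Delta t)$, the electric field $\mathbf{E}$ and $\boldsymbol{\psi}(\mathbf{x},t)=\int_0^\infty e^{-\gamma\tau}\mathbf{E}(\mathbf{x},t-\tau)\,d\tau$ in the dispersive (Drude) wave equation $\partial_t^2\mathbf{E}=c^2\Delta\mathbf{E}-\frac{\omega_p^2}{\epsilon_r}\mathbf{E}+\frac{\omega_p^2\gamma}{\epsilon_r}\boldsymbol{\psi}$. Here $c>0$ (wave speed), $\epsilon_r>0$ (relative permittivity), $\omega_p$ (plasma frequency) and $\gamma$ (damping coefficient) are real constants. The discrete Laplacian is $\Delta_{2h}=\sum_{d=1}^{\mathcal D}D_{+,x_d}D_{-,x_d}$, with $D_{+,x_d}u_{\mathbf j}=(u_{\mathbf j+e_d}-u_{\mathbf j})/h_d$ and $D_{-,x_d}u_{\mathbf j}=(u_{\mathbf j}-u_{\mathbf j-e_d})/h_d$, where $e_d$ is the $d$-th unit vector. "Nontrivial" means $(\mathbf{C}_E,\mathbf{C}_\psi)\neq(0,0)$. *)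

theory Defs
  imports "HOL-Analysis.Analysis"
begin

text \<open>Multi-indices in \<open>\<int>\<^sup>D\<close> are of type \<open>int ^ 'd\<close>, where \<open>D = CARD('d)\<close>; the
  grid spacings \<open>h\<^sub>1, \<dots>, h\<^sub>D\<close> are the components of \<open>h :: real ^ 'd\<close>.\<close>

definition grid_point :: "real ^ 'd \<Rightarrow> int ^ 'd \<Rightarrow> real ^ 'd" where
  "grid_point h j = (\<chi> d. real_of_int (j $ d) * h $ d)"

definition D_plus ::
    "real ^ 'd \<Rightarrow> 'd \<Rightarrow> (int ^ 'd \<Rightarrow> 'v::real_vector) \<Rightarrow> int ^ 'd \<Rightarrow> 'v" where
  "D_plus h d u j = (u (j + axis d 1) - u j) /\<^sub>R (h $ d)"

definition D_minus ::
    "real ^ 'd \<Rightarrow> 'd \<Rightarrow> (int ^ 'd \<Rightarrow> 'v::real_vector) \<Rightarrow> int ^ 'd \<Rightarrow> 'v" where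
  "D_minus h d u j = (u j - u (j - axis d 1)) /\<^sub>R (h $ d)"

definition discrete_laplacian ::
    "real ^ 'd::finite \<Rightarrow> (int ^ 'd \<Rightarrow> 'v::real_vector) \<Rightarrow> int ^ 'd \<Rightarrow> 'v" where
  "discrete_laplacian h u j = (\<Sum>d\<in>UNIV. D_plus h d (D_minus h d u) j)"

text \<open>Time levels are \<open>n = 0, 1, 2, \<dots>\<close>. The three-level update of \<open>E\<close> involves level
  \<open>n - 1\<close> and is therefore imposed for \<open>n \<ge> 1\<close>; the two-level update of \<open>\<psi>\<close> is imposed
  for all \<open>n \<ge> 0\<close>.\<close>

definition rc_scheme_solution ::
    "real ^ 'd::finite \<Rightarrow> real \<Rightarrow> real \<Rightarrow> real \<Rightarrow> real \<Rightarrow> real \<Rightarrow>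
     (nat \<Rightarrow> int ^ 'd \<Rightarrow> complex ^ 3) \<Rightarrow> (nat \<Rightarrow> int ^ 'd \<Rightarrow> complex ^ 3) \<Rightarrow> bool" where
  "rc_scheme_solution h dt c eps\<^sub>r \<omega>\<^sub>p \<gamma> E \<psi> \<longleftrightarrow>
     (\<forall>n\<ge>1. \<forall>j. E (n + 1) j =
        2 *\<^sub>R E n j - E (n - 1) j
        + dt\<^sup>2 *\<^sub>R (c\<^sup>2 *\<^sub>R discrete_laplacian h (E n) j
                  - (\<omega>\<^sub>p\<^sup>2 / eps\<^sub>r) *\<^sub>R E n j
                  + (\<omega>\<^sub>p\<^sup>2 * \<gamma> / eps\<^sub>r) *\<^sub>R \<psi> n j)) \<and>
     (\<forall>n j. \<psi> (n + 1) j =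
        (dt / 2) *\<^sub>R E (n + 1) j
        + (dt / 2 * exp (- \<gamma> * dt)) *\<^sub>R E n j
        + exp (- \<gamma> * dt) *\<^sub>R \<psi> n j)"

definition normal_mode ::
    "real ^ 'd::finite \<Rightarrow> real ^ 'd \<Rightarrow> complex \<Rightarrow> complex ^ 3 \<Rightarrow>
     nat \<Rightarrow> int ^ 'd \<Rightarrow> complex ^ 3" where
  "normal_mode h k A C n j =
     (A ^ n * exp (\<i> * complex_of_real (k \<bullet> grid_point h j))) *s C"

end

theory Submission
  imports Defs "HOL-Computational_Algebra.Fundamental_Theorem_Algebra"
begin

text \<open>Growth already occurs at wavenumber \<open>k = 0\<close>, where the discrete Laplacian vanishes. With
  \<open>b = dt\<^sup>2 \<omega>\<^sub>p\<^sup>2 / eps\<^sub>r\<close>, \<open>g = \<gamma> dt\<close> and \<open>z = exp (- g)\<close>, the mode \<open>A\<close> with amplitudes \<open>e\<close>, \<open>q\<close>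
  solves the scheme if \<open>((A - 1)\<^sup>2 + b A) e = b \<gamma> A q\<close> and \<open>(A - z) q = (dt / 2) (A + z) e\<close>.
  Eliminating the amplitudes leaves the requirement that \<open>A\<close> be a root of the real monic cubic
  \[ P(A) = ((A - 1)^2 + b A)(A - z) - \frac{b g}{2} A (A + z). \]
  The sign of \<open>\<gamma>\<close> decides why \<open>P\<close> has a root outside the closed unit disc.

  If \<open>g > 0\<close>, then \<open>P(1) = b (1 + z) (tanh (g / 2) - g / 2) < 0\<close>, while \<open>P\<close> is positive far to the
  right, so there is a real root beyond \<open>1\<close>: the trapezoidal rule for \<open>\<psi>\<close> overestimates the
  integral of the convex kernel \<open>exp (- \<gamma> \<tau>)\<close>, which makes the convolution term outweigh the
  restoring term.

  If \<open>g < 0\<close>, this sign is reversed, but the product of the three roots is \<open>- P(0) = z > 1\<close>, so the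
  roots cannot all lie in the unit disc.

  These two cases are combined in \<open>amplification_factor_exists\<close>, and
  \<open>constant_mode_solves_scheme\<close> turns a root into a solution of the scheme.\<close>

text \<open>The constant coefficient of a monic polynomial is, up to sign, the product of its roots.\<close>

lemma monic_root_outside_unit_disc:
  fixes p :: "complex poly"
  assumes "lead_coeff p = 1" and "cmod (poly p 0) > 1"
  obtains A where "poly p A = 0" and "cmod A > 1"
proof -
  have "p \<noteq> 0"
    using assms(1) by auto
  then obtain R where p: "p = (\<Prod>x\<in>#R. [:- x, 1:])"
    using alg_closed_imp_factorization[of p] assms(1) by auto
  have "cmod (poly p 0) \<le> 1" if "\<And>x. x \<in># R \<Longrightarrow> cmod x \<le> 1"
    unfolding p using that
    by (induction R) (auto simp: norm_mult intro: mult_le_one)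
  with assms(2) obtain x where x: "x \<in># R" "cmod x > 1"
    by force
  from x(1) have "poly p x = 0"
    unfolding p by (auto simp: poly_prod_mset prod_mset_zero_iff)
  with x(2) show thesis
    using that by blast
qed

text \<open>This is \<open>tanh (g / 2) < g / 2\<close> cleared of denominators. The difference of the two sides vanishes
  at \<open>0\<close>, and its derivative \<open>1 - (1 + x) exp (- x)\<close> is positive because \<open>1 + x < exp x\<close>.\<close>

lemma two_times_one_minus_exp_less:
  fixes g :: real
  assumes "g > 0"
  shows "2 * (1 - exp (- g)) < g * (1 + exp (- g))"
proof -
  let ?f = "\<lambda>x::real. x * (1 + exp (- x)) - 2 * (1 - exp (- x))"
  have "?f 0 < ?f g"
  proof (rule DERIV_pos_imp_increasing_open[OF assms])
    fix x :: real
    assume x: "0 < x"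
    have "1 + x < exp x"
      using x exp_minus_greater[of "-x"] by simp
    then have "(1 + x) * exp (- x) < exp x * exp (- x)"
      by simp
    then have "1 - (1 + x) * exp (- x) > 0"
      by (simp add: exp_minus)
    moreover have "(?f has_real_derivative 1 - (1 + x) * exp (- x)) (at x)"
      by (auto intro!: derivative_eq_intros simp: algebra_simps)
    ultimately show "\<exists>y. DERIV ?f x :> y \<and> y > 0"
      by blast
  qed (auto intro!: continuous_intros)
  then show ?thesis
    by simp
qed

text \<open>The amplification factor of the constant mode. For \<open>g > 0\<close> it comes from a sign change of the
  cubic on the real axis to the right of \<open>1\<close>; for \<open>g < 0\<close> it may be non-real, and only the product
  of the roots is used to find it.\<close>

lemma amplification_factor_exists:
  fixes b g :: real
  assumes b: "b > 0" and g: "g \<noteq> 0"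
  obtains A :: complex where "cmod A > 1"
    and "((A - 1)\<^sup>2 + of_real b * A) * (A - of_real (exp (- g)))
      = of_real (b * g / 2) * A * (A + of_real (exp (- g)))"
proof -
  define z where "z = exp (- g)"
  \<comment> \<open>The coefficients of the expanded cubic \<open>x\<^sup>3 + c2 x\<^sup>2 + c1 x - z\<close>.\<close>
  define c1 where "c1 = 1 + (2 - b) * z - b * g / 2 * z"
  define c2 where "c2 = b - 2 - z - b * g / 2"
  have "\<exists>A::complex. cmod A > 1 \<and> A ^ 3 + c2 * A\<^sup>2 + c1 * A - z = 0"
  proof (cases "g > 0")
    case True
    define p where "p = [:- z, c1, c2, 1:]"
    have "poly p 1 = b / 2 * (2 * (1 - z) - g * (1 + z))"
      by (simp add: p_def c1_def c2_def field_simps)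
    moreover have "2 * (1 - z) - g * (1 + z) < 0"
      using two_times_one_minus_exp_less[OF True] by (simp add: z_def)
    ultimately have neg: "poly p 1 < 0"
      using b mult_pos_neg[of "b / 2" "2 * (1 - z) - g * (1 + z)"] by linarith
    obtain N where N: "\<And>x. x \<ge> N \<Longrightarrow> poly p x \<ge> 1"
      using poly_pinfty_gt_lc[of p] by (auto simp: p_def)
    have "poly p (max 2 N) > 0" and "1 < max 2 N"
      using N[of "max 2 N"] by simp_all
    then obtain x where "x > 1" "poly p x = 0"
      using poly_IVT_pos[of 1 "max 2 N" p] neg by auto
    then have "x ^ 3 + c2 * x\<^sup>2 + c1 * x - z = 0"
      by (simp add: p_def algebra_simps power2_eq_square power3_eq_cube)
    then have "complex_of_real (x ^ 3 + c2 * x\<^sup>2 + c1 * x - z) = 0"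
      by simp
    with \<open>x > 1\<close> show ?thesis
      by (intro exI[of _ "complex_of_real x"]) simp
  next
    case False
    with g have "z > 1"
      by (simp add: z_def)
    then obtain A where A: "cmod A > 1"
      and "poly [:- of_real z, of_real c1, of_real c2, 1:] A = 0"
      using monic_root_outside_unit_disc[of "[:- of_real z, of_real c1, of_real c2, 1:]"]
      by auto
    then have "A ^ 3 + c2 * A\<^sup>2 + c1 * A - z = 0"
      by (simp add: algebra_simps power2_eq_square power3_eq_cube)
    with A show ?thesis
      by blast
  qed
  then obtain A :: complex where A: "cmod A > 1" "A ^ 3 + c2 * A\<^sup>2 + c1 * A - z = 0"
    by blast
  have "((A - 1)\<^sup>2 + of_real b * A) * (A - of_real z) - of_real (b * g / 2) * A * (A + of_real z)
      = A ^ 3 + c2 * A\<^sup>2 + c1 * A - z"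
    by (simp add: c1_def c2_def field_simps power2_eq_square power3_eq_cube)
  with A show thesis
    using that unfolding z_def by simp
qed

lemma discrete_laplacian_const:
  "discrete_laplacian h (\<lambda>j. v) j = 0"
  by (simp add: discrete_laplacian_def D_plus_def D_minus_def)

lemma normal_mode_zero_wavenumber:
  "normal_mode h 0 A C n = (\<lambda>j. A ^ n *s C)"
  by (simp add: normal_mode_def fun_eq_iff)

text \<open>For \<open>k = 0\<close> the mode is constant in space, so both updates become scalar recurrences in time,
  carried along a common direction \<open>v\<close>. The two hypotheses are these recurrences with the common
  power of \<open>A\<close> cancelled.\<close>

lemma constant_mode_solves_scheme:
  fixes h :: "real ^ 'd::finite" and dt c eps\<^sub>r \<omega>\<^sub>p \<gamma> :: real
    and A e q :: complex and v :: "complex ^ 3"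
  defines "b \<equiv> dt\<^sup>2 * (\<omega>\<^sub>p\<^sup>2 / eps\<^sub>r)" and "z \<equiv> exp (- \<gamma> * dt)"
  assumes E: "(A - 1)\<^sup>2 * e + of_real b * A * e = of_real (b * \<gamma>) * A * q"
    and \<psi>: "(A - of_real z) * q = of_real (dt / 2) * (A + of_real z) * e"
  shows "rc_scheme_solution h dt c eps\<^sub>r \<omega>\<^sub>p \<gamma>
           (normal_mode h 0 A (e *s v)) (normal_mode h 0 A (q *s v))"
  unfolding rc_scheme_solution_def normal_mode_zero_wavenumber discrete_laplacian_const
proof (intro conjI allI impI)
  fix n :: nat and j :: "int ^ 'd"
  assume "n \<ge> 1"
  then obtain m where n: "n = Suc m"
    by (cases n) auto
  have E': "A\<^sup>2 * e = 2 * A * e - e - of_real b * A * e + of_real (b * \<gamma>) * A * q"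
    using E by (simp add: power2_eq_square algebra_simps)
  have comp: "A ^ (n + 1) * (e * v $ i) = 2 * (A ^ n * (e * v $ i)) - A ^ (n - 1) * (e * v $ i)
      - of_real b * (A ^ n * (e * v $ i)) + of_real (b * \<gamma>) * (A ^ n * (q * v $ i))" for i
    using arg_cong[OF E', of "\<lambda>x. A ^ m * x * v $ i"]
    by (simp add: n power2_eq_square algebra_simps)
  have "A ^ (n + 1) *s (e *s v) = 2 *\<^sub>R (A ^ n *s (e *s v)) - A ^ (n - 1) *s (e *s v)
      - b *\<^sub>R (A ^ n *s (e *s v)) + (b * \<gamma>) *\<^sub>R (A ^ n *s (q *s v))"
    unfolding vec_eq_iff using comp
    by (simp add: scaleR_conv_of_real[where 'a = complex] mult.assoc)
  then show "A ^ (n + 1) *s (e *s v) = 2 *\<^sub>R (A ^ n *s (e *s v)) - A ^ (n - 1) *s (e *s v)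
        + dt\<^sup>2 *\<^sub>R (c\<^sup>2 *\<^sub>R 0 - (\<omega>\<^sub>p\<^sup>2 / eps\<^sub>r) *\<^sub>R (A ^ n *s (e *s v))
                  + (\<omega>\<^sub>p\<^sup>2 * \<gamma> / eps\<^sub>r) *\<^sub>R (A ^ n *s (q *s v)))"
    by (simp add: b_def scaleR_right_distrib scaleR_right_diff_distrib)
next
  fix n :: nat and j :: "int ^ 'd"
  have \<psi>': "A * q = of_real (dt / 2) * A * e + of_real (dt / 2 * z) * e + of_real z * q"
    using \<psi> by (simp add: field_simps)
  have comp: "A ^ (n + 1) * (q * v $ i) = of_real (dt / 2) * (A ^ (n + 1) * (e * v $ i))
      + of_real (dt / 2 * z) * (A ^ n * (e * v $ i)) + of_real z * (A ^ n * (q * v $ i))" for i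
    using arg_cong[OF \<psi>', of "\<lambda>x. A ^ n * x * v $ i"] by (simp add: algebra_simps)
  have "A ^ (n + 1) *s (q *s v) = (dt / 2) *\<^sub>R (A ^ (n + 1) *s (e *s v))
      + (dt / 2 * z) *\<^sub>R (A ^ n *s (e *s v)) + z *\<^sub>R (A ^ n *s (q *s v))"
    unfolding vec_eq_iff using comp
    by (simp add: scaleR_conv_of_real[where 'a = complex] mult.assoc)
  then show "A ^ (n + 1) *s (q *s v) = (dt / 2) *\<^sub>R (A ^ (n + 1) *s (e *s v))
      + (dt / 2 * exp (- \<gamma> * dt)) *\<^sub>R (A ^ n *s (e *s v))
      + exp (- \<gamma> * dt) *\<^sub>R (A ^ n *s (q *s v))"
    unfolding z_def .
qed

theorem proposition3p1:
  fixes h :: "real ^ 'd::finite"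
    and dt c eps\<^sub>r \<omega>\<^sub>p \<gamma> :: real
  assumes "\<forall>d. h $ d > 0"
    and "dt > 0" and "c > 0" and "eps\<^sub>r > 0"
    and "\<gamma> \<noteq> 0" and "\<omega>\<^sub>p \<noteq> 0"
  shows "\<exists>(k :: real ^ 'd) (A :: complex) (C\<^sub>E :: complex ^ 3) (C\<^sub>\<psi> :: complex ^ 3).
           (C\<^sub>E, C\<^sub>\<psi>) \<noteq> (0, 0) \<and> cmod A > 1 \<and>
           rc_scheme_solution h dt c eps\<^sub>r \<omega>\<^sub>p \<gamma>
             (normal_mode h k A C\<^sub>E) (normal_mode h k A C\<^sub>\<psi>)"
proof -
  define b where "b = dt\<^sup>2 * (\<omega>\<^sub>p\<^sup>2 / eps\<^sub>r)"
  define z where "z = exp (- \<gamma> * dt)"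
  have "b > 0" and "\<gamma> * dt \<noteq> 0"
    using assms by (simp_all add: b_def)
  then obtain A :: complex where A: "cmod A > 1"
    and root: "((A - 1)\<^sup>2 + of_real b * A) * (A - of_real z)
      = of_real (b * (\<gamma> * dt) / 2) * A * (A + of_real z)"
    using amplification_factor_exists[of b "\<gamma> * dt"] by (auto simp: z_def)
  \<comment> \<open>This choice of amplitudes solves the \<open>\<psi>\<close> update without dividing by \<open>A - z\<close>.\<close>
  define e where "e = A - of_real z"
  define q where "q = of_real (dt / 2) * (A + of_real z)"
  have "e \<noteq> 0 \<or> q \<noteq> 0"
  proof (rule ccontr)
    assume "\<not> ?thesis"
    then have "A = z" and "A = - z"
      using \<open>dt > 0\<close> by (auto simp: e_def q_def eq_neg_iff_add_eq_0)
    with A show False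
      by auto
  qed
  then have "(e *s 1 :: complex ^ 3, q *s 1 :: complex ^ 3) \<noteq> (0, 0)"
    by (auto simp: vec_eq_iff)
  moreover have "rc_scheme_solution h dt c eps\<^sub>r \<omega>\<^sub>p \<gamma>
      (normal_mode h 0 A (e *s 1)) (normal_mode h 0 A (q *s 1))"
  proof (rule constant_mode_solves_scheme, fold b_def z_def)
    show "(A - of_real z) * q = of_real (dt / 2) * (A + of_real z) * e"
      by (simp add: e_def q_def)
    show "(A - 1)\<^sup>2 * e + of_real b * A * e = of_real (b * \<gamma>) * A * q"
      using root by (simp add: e_def q_def algebra_simps)
  qed
  ultimately show ?thesis
    using A by blast
qed

end
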